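(* Let $s\in(1,\infty)$. Define, for $p\in(0,1)$, $$f_{p|r=1,s}(p)=\frac{(-\ln p)^{s-1}}{\zeta(s)\,\Gamma(s)\,(1-p)}.$$ Then $f_{p|r=1,s}$ is a probability density function on $(0,1)$, and the $\mathrm{Zeta}(s)$ distribution is the mixture of the $\mathrm{Negative\ Binomial}(r=1,p)$ distributions with mixing density $f_{p|r=1,s}$; that is, for every $x\in\{0,1,2,\ldots\}$, $$\int_0^1 p^x(1-p)\, f_{p|r=1,s}(p)\,dp=\frac{(x+1)^{-s}}{\zeta(s)}.$$ Moreover, this mixing distribution is unique: if $\mu$ is a probability measure on $(0,1)$ such that $\int_{(0,1)} p^x(1-p)\,\mu(dp)=\frac{(x+1)^{-s}}{\zeta(s)}$ for every $x\in\{0,1,2,\ldots\}$, then $\mu$ is the probability measure with density $f_{p|r=1,s}$.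
   Context: $\zeta(s)=\sum_{x=0}^{\infty}(x+1)^{-s}$ is the Riemann zeta function (for $s>1$) and $\Gamma$ is the Gamma function. The $\mathrm{Zeta}(s)$ distribution, $s\in(1,\infty)$, is the distribution on $\{0,1,2,\ldots\}$ with probability mass function $\frac{(x+1)^{-s}}{\zeta(s)}$. The $\mathrm{Negative\ Binomial}(r,p)$ distribution, $r\in(0,\infty)$, $p\in(0,1)$, is the distribution on $\{0,1,2,\ldots\}$ with probability mass function $\frac{\Gamma(r+x)}{\Gamma(r)\Gamma(x+1)}p^x(1-p)^r$; for $r=1$ this equals $p^x(1-p)$. *)

theory Defs
  imports "HOL-Probability.Probability"
begin

text \<open>The Riemann zeta function on the half-line \<open>s > 1\<close>. For \<open>s \<le> 1\<close> the series diverges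
  and the value carries no meaning.\<close>

definition zeta_real :: "real \<Rightarrow> real" where
  "zeta_real s = (\<Sum>x::nat. (real x + 1) powr (- s))"

definition zeta_mass :: "real \<Rightarrow> nat \<Rightarrow> real" where
  "zeta_mass s x = (real x + 1) powr (- s) / zeta_real s"

text \<open>The parameter \<open>p\<close> is the base of the \<open>x\<close>-th power, and \<open>r\<close> is any positive real. The library's
  \<open>neg_binomial_pmf\<close> uses \<open>1 - p\<close> in place of \<open>p\<close> and a natural number \<open>r\<close>.\<close>

definition neg_binomial_mass :: "real \<Rightarrow> real \<Rightarrow> nat \<Rightarrow> real" where
  "neg_binomial_mass r p x =
     Gamma (r + real x) / (Gamma r * Gamma (real x + 1)) * p ^ x * (1 - p) powr r"

lemma neg_binomial_mass_1:
  assumes "0 < p" "p < 1"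
  shows "neg_binomial_mass 1 p x = p ^ x * (1 - p)"
proof -
  have "Gamma (real x + 1) \<noteq> 0"
    using Gamma_real_pos [of "real x + 1"] by linarith
  then show ?thesis using assms by (simp add: neg_binomial_mass_def add.commute [of 1])
qed

definition mixing_density :: "real \<Rightarrow> real \<Rightarrow> real" where
  "mixing_density s p = (- ln p) powr (s - 1) / (zeta_real s * Gamma s * (1 - p))"

text \<open>The measure with density \<open>mixing_density s\<close>, living on the Borel sets of \<open>(0,1)\<close>.\<close>

definition mixing_measure :: "real \<Rightarrow> real measure" where
  "mixing_measure s =
     density (restrict_space lborel {0<..<1}) (\<lambda>p. ennreal (mixing_density s p))"

end

theory Submission
  imports Defs
begin

text \<open>The mixing density comes from the Gamma integral. Substituting \<open>p = exp (- t / a)\<close> in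
  \<open>\<Gamma>(s) = \<integral>\<^sub>0\<^sup>\<infinity> t\<^sup>s\<^sup>-\<^sup>1 e\<^sup>-\<^sup>t dt\<close> gives
  \<open>\<integral>\<^sub>0\<^sup>1 p\<^sup>a\<^sup>-\<^sup>1 (- ln p)\<^sup>s\<^sup>-\<^sup>1 dp = \<Gamma>(s) a\<^sup>-\<^sup>s\<close>
  (\<open>has_bochner_integral_powr_mult_neg_ln_powr\<close>). In the mixture the factor \<open>1 - p\<close> of the geometric
  mass cancels the denominator of the density, and what remains is this integral at \<open>a = x + 1\<close>, up
  to the constant \<open>\<zeta>(s) \<Gamma>(s)\<close> (\<open>has_bochner_integral_mixture\<close>).

  That the density has total mass \<open>1\<close> follows from the mixture identity itself: for each \<open>p\<close> the
  geometric masses sum to \<open>1\<close>, so summing the identity over \<open>x\<close> and exchanging sum and integral,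
  which is harmless for nonnegative terms, turns the mass of the density into the mass of the zeta
  distribution (\<open>has_bochner_integral_mixing_density\<close>).

  For uniqueness, a mixing measure enters only through the integrals of \<open>p\<^sup>x (1 - p)\<close>, that is,
  through the differences of consecutive moments; as it has mass \<open>1\<close>, these determine all its moments
  (\<open>measure_unit_interval_eqI_neg_binomial\<close>). A bounded distribution is determined by its moments,
  because its characteristic function is the sum of its moment series and the characteristic
  function determines the distribution (\<open>bounded_real_distribution_eqI_moments\<close>).\<close>

section \<open>The integral of a power of the logarithm\<close>

text \<open>This is the Mellin transform of \<open>(- ln p)\<^sup>s\<^sup>-\<^sup>1\<close> on the unit interval. The substitution is scaled by
  \<open>a\<close> so that it leads to the Gamma integral in its standard form.\<close>

lemma has_bochner_integral_powr_mult_neg_ln_powr: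
  fixes a s :: real
  assumes a: "a > 0" and s: "s > 0"
  shows "has_bochner_integral lborel
           (\<lambda>p. indicator {0<..<1} p *\<^sub>R (p powr (a - 1) * (- ln p) powr (s - 1)))
           (Gamma s * a powr (- s))"
proof -
  define f where "f = (\<lambda>p::real. p powr (a - 1) * (- ln p) powr (s - 1))"
  define g where "g = (\<lambda>t::real. exp (- t / a))"
  define g' where "g' = (\<lambda>t::real. - exp (- t / a) / a)"
  let ?h = "\<lambda>t. t powr (s - 1) / exp t"
  have img: "g ` {0<..} = {0<..<1}"
  proof (intro equalityI subsetI)
    fix p assume "p \<in> g ` {0<..}"
    then show "p \<in> {0<..<1}" using a by (auto simp: g_def)
  next
    fix p :: real assume "p \<in> {0<..<1}"
    then have "p = g (- a * ln p)" "- a * ln p > 0"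
      using a by (auto simp: g_def mult_less_0_iff)
    then show "p \<in> g ` {0<..}" by blast
  qed
  have pullback: "\<bar>g' t\<bar> * f (g t) = a powr (- s) * ?h t" if "t > 0" for t
  proof -
    have f_g: "f (g t) = exp (- t / a * (a - 1)) * (t powr (s - 1) / a powr (s - 1))"
      using that a by (simp add: f_def g_def powr_def[of "exp _"] powr_divide mult.commute)
    have exps: "exp (- t / a) * exp (- t / a * (a - 1)) = 1 / exp t"
      using a by (simp add: exp_minus[symmetric] exp_add[symmetric] field_simps)
    have as: "a * a powr (s - 1) = a powr s"
      using a by (simp add: powr_mult_base)
    have "\<bar>g' t\<bar> = exp (- t / a) / a"
      using a by (simp add: g'_def)
    with f_g have "\<bar>g' t\<bar> * f (g t) =
        (exp (- t / a) * exp (- t / a * (a - 1))) * (t powr (s - 1) / (a * a powr (s - 1)))"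
      by simp
    also have "\<dots> = a powr (- s) * ?h t"
      unfolding exps as by (simp add: powr_minus divide_inverse)
    finally show ?thesis .
  qed
  have h_int: "(?h has_integral Gamma s) {0<..}"
  proof (subst has_integral_spike_set_eq)
    show "negligible {t \<in> {0<..} - {0..}. ?h t \<noteq> 0}"
      by (rule negligible_subset[of "{0}"]) auto
    show "negligible {t \<in> {0..} - {0<..}. ?h t \<noteq> 0}"
      by (rule negligible_subset[of "{0}"]) auto
  qed (rule Gamma_integral_real[OF s])
  then have "?h absolutely_integrable_on {0<..}"
    by (intro nonnegative_absolutely_integrable_1) (auto simp: has_integral_integrable)
  then have "(\<lambda>t. a powr (- s) * ?h t) absolutely_integrable_on {0<..}"
    by (rule set_integrable_mult_right)
  then have abs_int: "(\<lambda>t. \<bar>g' t\<bar> * f (g t)) absolutely_integrable_on {0<..}"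
    by (subst set_integrable_cong[OF refl refl, of _ _ "\<lambda>t. a powr (- s) * ?h t"])
       (simp_all only: pullback greaterThan_iff)
  have "integral {0<..} (\<lambda>t. \<bar>g' t\<bar> * f (g t)) = integral {0<..} (\<lambda>t. a powr (- s) * ?h t)"
    by (rule Henstock_Kurzweil_Integration.integral_cong) (simp only: pullback greaterThan_iff)
  also have "\<dots> = a powr (- s) * Gamma s"
    by (rule integral_unique[OF has_integral_mult_right[OF h_int]])
  finally have integral: "integral {0<..} (\<lambda>t. \<bar>g' t\<bar> * f (g t)) = a powr (- s) * Gamma s" .
  have deriv: "(g has_field_derivative g' t) (at t within {0<..})" for t
    unfolding g_def g'_def using a by (auto intro!: derivative_eq_intros)
  have inj: "inj_on g {0<..}"
    using a by (auto simp: g_def inj_on_def)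
  have "f absolutely_integrable_on (g ` {0<..}) \<and> integral (g ` {0<..}) f = a powr (- s) * Gamma s"
    by (rule iffD1[OF has_absolute_integral_change_of_variables_1'[OF _ deriv inj] conjI[OF abs_int integral]])
       simp
  then have f: "f absolutely_integrable_on {0<..<1}" "integral {0<..<1} f = a powr (- s) * Gamma s"
    by (simp_all only: img)
  \<comment> \<open>So far integrability is with respect to the completed Lebesgue measure; Borel measurability of
    the integrand allows a return to the Borel--Lebesgue measure.\<close>
  have meas: "(\<lambda>p. indicator {0<..<1} p *\<^sub>R f p) \<in> borel_measurable lborel"
    unfolding f_def by measurable
  have "integrable lborel (\<lambda>p. indicator {0<..<1} p *\<^sub>R f p)"
    using f(1) integrable_completion[OF meas] by (simp add: set_integrable_def)
  moreover have "integral\<^sup>L lborel (\<lambda>p. indicator {0<..<1} p *\<^sub>R f p) = a powr (- s) * Gamma s"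
    using set_lebesgue_integral_eq_integral(2)[OF f(1)] f(2) integral_completion[OF meas]
    by (simp add: set_lebesgue_integral_def)
  ultimately show ?thesis
    by (simp add: has_bochner_integral_iff f_def mult.commute)
qed

corollary has_bochner_integral_power_mult_neg_ln_powr:
  fixes s :: real and n :: nat
  assumes "s > 0"
  shows "has_bochner_integral lborel
           (\<lambda>p. indicator {0<..<1} p *\<^sub>R (p ^ n * (- ln p) powr (s - 1)))
           (Gamma s * (real n + 1) powr (- s))"
proof -
  have "(\<lambda>p. indicator {0<..<1} p *\<^sub>R (p powr ((real n + 1) - 1) * (- ln p) powr (s - 1)))
      = (\<lambda>p. indicator {0<..<1} p *\<^sub>R (p ^ n * (- ln p) powr (s - 1)))"
    by (auto simp: indicator_def powr_realpow fun_eq_iff)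
  then show ?thesis
    using has_bochner_integral_powr_mult_neg_ln_powr[of "real n + 1" s] assms by simp
qed

section \<open>The mixing density\<close>

lemma zeta_real_sums:
  assumes "s > 1"
  shows "(\<lambda>n. (real n + 1) powr (- s)) sums zeta_real s"
proof -
  have "summable (\<lambda>n. real (Suc n) powr (- s))"
    using assms by (subst summable_Suc_iff) (simp add: summable_real_powr_iff)
  then show ?thesis
    by (simp add: zeta_real_def summable_sums add.commute)
qed

lemma zeta_real_pos:
  assumes "s > 1"
  shows "zeta_real s > 0"
  unfolding zeta_real_def
  using sums_summable[OF zeta_real_sums[OF assms]] by (intro suminf_pos) auto

lemma mixing_density_nonneg:
  assumes "s > 1" "p \<in> {0<..<1}"
  shows "0 \<le> mixing_density s p"
  using assms zeta_real_pos[of s] Gamma_real_pos[of s] by (simp add: mixing_density_def)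

lemma borel_measurable_mixing_density [measurable]: "mixing_density s \<in> borel_measurable borel"
  unfolding mixing_density_def by measurable

lemma borel_measurable_neg_binomial_mass [measurable]:
  "(\<lambda>p. neg_binomial_mass r p n) \<in> borel_measurable borel"
  unfolding neg_binomial_mass_def by measurable

lemma has_bochner_integral_mixture:
  assumes s: "s > 1"
  shows "has_bochner_integral lborel
           (\<lambda>p. indicator {0<..<1} p *\<^sub>R (neg_binomial_mass 1 p n * mixing_density s p))
           (zeta_mass s n)"
proof -
  have Gamma_pos: "Gamma s > 0"
    using s by (intro Gamma_real_pos) simp
  have "indicator {0<..<1} p *\<^sub>R (neg_binomial_mass 1 p n * mixing_density s p) =
      (indicator {0<..<1} p *\<^sub>R (p ^ n * (- ln p) powr (s - 1))) / (zeta_real s * Gamma s)"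
    for p :: real
    by (cases "p \<in> {0<..<1}") (simp_all add: neg_binomial_mass_1 mixing_density_def)
  moreover have "Gamma s * (real n + 1) powr (- s) / (zeta_real s * Gamma s) = zeta_mass s n"
    using Gamma_pos by (simp add: zeta_mass_def)
  ultimately show ?thesis
    using has_bochner_integral_divide_zero[OF
        has_bochner_integral_power_mult_neg_ln_powr[of s n], of "zeta_real s * Gamma s"] s
    by simp
qed

lemma zeta_mass_sums_1:
  assumes "s > 1"
  shows "zeta_mass s sums 1"
  using sums_divide[OF zeta_real_sums[OF assms], of "zeta_real s"] zeta_real_pos[OF assms]
  by (simp add: zeta_mass_def[abs_def])

text \<open>The density is the sum over \<open>n\<close> of its products with the geometric masses; the \<open>n\<close>-th product
  has integral \<open>zeta_mass s n\<close>.\<close>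

lemma has_bochner_integral_mixing_density:
  assumes s: "s > 1"
  shows "has_bochner_integral lborel (\<lambda>p. indicator {0<..<1} p *\<^sub>R mixing_density s p) 1"
proof -
  let ?f = "\<lambda>n p. indicator {0<..<1} p *\<^sub>R (neg_binomial_mass 1 p n * mixing_density s p)"
  have f: "integrable lborel (?f n)" "integral\<^sup>L lborel (?f n) = zeta_mass s n" for n
    using has_bochner_integral_mixture[OF s, of n] by (auto simp: has_bochner_integral_iff)
  have norm_f: "norm (?f n p) = ?f n p" for n p
    using mixing_density_nonneg[OF s] by (auto simp: indicator_def neg_binomial_mass_1)
  have sums: "(\<lambda>n. ?f n p) sums (indicator {0<..<1} p *\<^sub>R mixing_density s p)" for p :: real
  proof (cases "p \<in> {0<..<1}")
    case True
    then have "(\<lambda>n. p ^ n * ((1 - p) * mixing_density s p)) sums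
        (1 / (1 - p) * ((1 - p) * mixing_density s p))"
      by (intro sums_mult2 geometric_sums) auto
    with True show ?thesis by (simp add: neg_binomial_mass_1 mult.assoc)
  qed simp
  have eq: "(\<lambda>p. \<Sum>n. ?f n p) = (\<lambda>p. indicator {0<..<1} p *\<^sub>R mixing_density s p)"
    using sums by (simp add: fun_eq_iff sums_iff)
  have summ: "summable (\<lambda>n. LINT p|lborel. norm (?f n p))"
    using zeta_mass_sums_1[OF s] by (simp only: norm_f f(2) sums_summable)
  have ae: "AE p in lborel. summable (\<lambda>n. norm (?f n p))"
    using sums by (simp only: norm_f) (auto simp: sums_iff)
  have "integrable lborel (\<lambda>p. \<Sum>n. ?f n p)"
    by (rule integrable_suminf[OF f(1) ae summ])
  moreover have "integral\<^sup>L lborel (\<lambda>p. \<Sum>n. ?f n p) = (\<Sum>n. zeta_mass s n)"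
    using integral_suminf[OF f(1) ae summ] by (simp only: f(2))
  ultimately show ?thesis
    using zeta_mass_sums_1[OF s] by (simp only: eq has_bochner_integral_iff sums_iff)
qed

lemma sets_mixing_measure: "sets (mixing_measure s) = sets (restrict_space borel {0<..<1})"
  by (simp add: mixing_measure_def sets_restrict_space)

lemma prob_space_mixing_measure:
  assumes s: "s > 1"
  shows "prob_space (mixing_measure s)"
proof (rule prob_spaceI)
  have int: "integrable lborel (\<lambda>p. indicator {0<..<1} p *\<^sub>R mixing_density s p)"
      "integral\<^sup>L lborel (\<lambda>p. indicator {0<..<1} p *\<^sub>R mixing_density s p) = 1"
    using has_bochner_integral_mixing_density[OF s] by (auto simp: has_bochner_integral_iff)
  have "emeasure (mixing_measure s) (space (mixing_measure s)) =
      (\<integral>\<^sup>+p. ennreal (mixing_density s p) * indicator {0<..<1} p \<partial>restrict_space lborel {0<..<1})"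
    unfolding mixing_measure_def
    by (subst emeasure_density)
       (auto simp: space_restrict_space sets_restrict_space_iff intro!: measurable_restrict_space1)
  also have "\<dots> = (\<integral>\<^sup>+p. ennreal (indicator {0<..<1} p *\<^sub>R mixing_density s p) \<partial>lborel)"
    by (subst nn_integral_restrict_space) (auto intro!: nn_integral_cong simp: indicator_def)
  also have "\<dots> = 1"
    using int mixing_density_nonneg[OF s]
    by (subst nn_integral_eq_integral) (auto simp: indicator_def)
  finally show "emeasure (mixing_measure s) (space (mixing_measure s)) = 1" .
qed

lemma integral_mixing_measure_neg_binomial_mass:
  assumes s: "s > 1"
  shows "(LINT p|mixing_measure s. neg_binomial_mass 1 p n) = zeta_mass s n"
proof -
  have "(LINT p|mixing_measure s. neg_binomial_mass 1 p n) =
      (LINT p|restrict_space lborel {0<..<1}. mixing_density s p *\<^sub>R neg_binomial_mass 1 p n)"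
    unfolding mixing_measure_def using mixing_density_nonneg[OF s]
    by (intro integral_density)
       (auto intro!: measurable_restrict_space1 AE_I2 simp: space_restrict_space)
  also have "\<dots> = zeta_mass s n"
    using has_bochner_integral_mixture[OF s, of n]
    by (subst integral_restrict_space) (auto simp: has_bochner_integral_iff mult.commute)
  finally show ?thesis .
qed

section \<open>Uniqueness\<close>

text \<open>A bounded distribution has an entire characteristic function, whose Taylor coefficients at
  \<open>0\<close> are its moments up to constants: if \<open>\<bar>x\<bar> \<le> B\<close> almost surely, the \<open>n\<close>-th absolute moment is at
  most \<open>B ^ n\<close>, so the Taylor remainder is at most \<open>2 (\<bar>t\<bar> B)\<^sup>n / n!\<close>, which vanishes for every \<open>t\<close>.\<close>

lemma (in real_distribution) char_LIMSEQ_moment_series: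
  assumes bounded: "AE x in M. \<bar>x\<bar> \<le> B"
  shows "(\<lambda>n. \<Sum>k\<le>n. ((\<i> * t) ^ k / fact k) * expectation (\<lambda>x. x ^ k)) \<longlonglongrightarrow> char M t"
proof -
  have ae: "AE x in M. \<bar>x\<bar> ^ k \<le> B ^ k" for k
    using bounded by eventually_elim (simp add: power_mono)
  have int: "integrable M (\<lambda>x. x ^ k)" for k
    using ae[of k] by (intro integrable_const_bound[of _ "B ^ k"]) (auto simp: power_abs)
  have le: "expectation (\<lambda>x. \<bar>x\<bar> ^ n) \<le> B ^ n" for n
    using integral_mono_AE[of M "\<lambda>x. \<bar>x\<bar> ^ n" "\<lambda>_. B ^ n"] ae[of n] integrable_abs[OF int[of n]]
    using prob_space by (simp add: power_abs)
  have "(\<lambda>n. 2 * ((\<bar>t\<bar> * B) ^ n / fact n)) \<longlonglongrightarrow> 2 * 0"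
    using summable_LIMSEQ_zero[OF summable_exp[of "\<bar>t\<bar> * B"]]
    by (intro tendsto_mult tendsto_const) (simp add: divide_inverse mult.commute)
  then have lim: "(\<lambda>n. 2 * \<bar>t\<bar> ^ n / fact n * B ^ n) \<longlonglongrightarrow> 0"
    by (simp add: power_mult_distrib mult.assoc)
  have "cmod ((\<Sum>k\<le>n. ((\<i> * t) ^ k / fact k) * expectation (\<lambda>x. x ^ k)) - char M t)
      \<le> 2 * \<bar>t\<bar> ^ n / fact n * B ^ n" for n
  proof -
    have "cmod (char M t - (\<Sum>k\<le>n. ((\<i> * t) ^ k / fact k) * expectation (\<lambda>x. x ^ k)))
        \<le> (2 * \<bar>t\<bar> ^ n / fact n) * expectation (\<lambda>x. \<bar>x\<bar> ^ n)"
      by (rule char_approx1[OF int])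
    also have "\<dots> \<le> 2 * \<bar>t\<bar> ^ n / fact n * B ^ n"
      by (rule mult_left_mono[OF le]) simp
    finally show ?thesis
      by (simp only: norm_minus_commute)
  qed
  then show ?thesis
    by (rule LIM_zero_cancel[OF Lim_null_comparison[OF always_eventually[OF allI] lim]])
qed

text \<open>The moment problem on a bounded interval is determinate.\<close>

lemma bounded_real_distribution_eqI_moments:
  assumes "real_distribution M" "real_distribution N"
    and "AE x in M. \<bar>x\<bar> \<le> B" "AE x in N. \<bar>x\<bar> \<le> B"
    and moments: "\<And>k. (LINT x|M. x ^ k) = (LINT x|N. x ^ k)"
  shows "M = N"
proof (rule Levy_uniqueness[OF assms(1,2)], rule ext)
  fix t
  show "char M t = char N t"
    using real_distribution.char_LIMSEQ_moment_series[OF assms(1,3), of t]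
      real_distribution.char_LIMSEQ_moment_series[OF assms(2,4), of t]
    by (simp only: moments LIMSEQ_unique)
qed

text \<open>Since \<open>p\<^sup>n (1 - p) = p\<^sup>n - p\<^sup>n\<^sup>+\<^sup>1\<close>, the geometric mixture probabilities are the successive
  differences of the moments of the mixing measure. The moment of order \<open>0\<close> is the total mass, hence
  \<open>1\<close>, so the differences determine all the moments.\<close>

lemma measure_unit_interval_eqI_neg_binomial:
  fixes \<mu> \<nu> :: "real measure"
  assumes prob: "prob_space \<mu>" "prob_space \<nu>"
    and sets: "sets \<mu> = sets (restrict_space borel {0<..<1})"
      "sets \<nu> = sets (restrict_space borel {0<..<1})"
    and eq: "\<And>n. (LINT p|\<mu>. neg_binomial_mass 1 p n) = (LINT p|\<nu>. neg_binomial_mass 1 p n)"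
  shows "\<mu> = \<nu>"
proof -
  have space: "space M = {0<..<1}"
    if "sets M = sets (restrict_space borel {0<..<1::real})" for M
    using sets_eq_imp_space_eq[OF that] by (simp add: space_restrict_space)
  have meas: "f \<in> borel_measurable M"
    if "sets M = sets (restrict_space borel {0<..<1::real})" "f \<in> borel_measurable borel"
    for M :: "real measure" and f :: "real \<Rightarrow> real"
    using measurable_restrict_space1[OF that(2), of "{0<..<1}"]
      measurable_cong_sets[OF that(1) refl, of borel] by blast
  have step: "(LINT p|M. p ^ Suc n) = (LINT p|M. p ^ n) - (LINT p|M. neg_binomial_mass 1 p n)"
    if M: "prob_space M" "sets M = sets (restrict_space borel {0<..<1::real})"
    for M :: "real measure" and n
  proof -
    interpret prob_space M by fact
    have int: "integrable M (\<lambda>p. p ^ k)" for k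
      using space[OF M(2)] meas[OF M(2), of "\<lambda>p. p ^ k"]
      by (intro integrable_const_bound[of _ 1]) (auto intro!: AE_I2 power_le_one)
    have "(LINT p|M. neg_binomial_mass 1 p n) = (LINT p|M. p ^ n - p ^ Suc n)"
      using space[OF M(2)]
      by (intro Bochner_Integration.integral_cong) (auto simp: neg_binomial_mass_1 algebra_simps)
    also have "\<dots> = (LINT p|M. p ^ n) - (LINT p|M. p ^ Suc n)"
      by (rule Bochner_Integration.integral_diff[OF int int])
    finally show ?thesis by simp
  qed
  have moments: "(LINT p|\<mu>. p ^ n) = (LINT p|\<nu>. p ^ n)" for n
  proof (induction n)
    case 0
    show ?case
      using prob by (simp add: prob_space.prob_space)
  next
    case (Suc n)
    then show ?case
      by (simp only: step[OF prob(1) sets(1)] step[OF prob(2) sets(2)] eq)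
  qed
  \<comment> \<open>The moment criterion speaks of measures on the whole line, so both measures are pushed forward
    along the inclusion of the interval.\<close>
  have distr: "real_distribution (distr M borel (\<lambda>p. p)) \<and>
      (AE p in distr M borel (\<lambda>p. p). \<bar>p\<bar> \<le> 1) \<and>
      (\<forall>k. (LINT p|distr M borel (\<lambda>p. p). p ^ k) = (LINT p|M. p ^ k))"
    if M: "prob_space M" "sets M = sets (restrict_space borel {0<..<1::real})" for M
  proof -
    have id: "(\<lambda>p. p) \<in> borel_measurable M"
      by (rule meas[OF M(2)]) simp
    have "AE p in M. \<bar>p\<bar> \<le> 1"
      by (rule AE_I2) (simp add: space[OF M(2)])
    then show ?thesis
      using prob_space.real_distribution_distr[OF M(1) id]
      by (simp add: AE_distr_iff[OF id] integral_distr[OF id])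
  qed
  have distr_eq: "distr \<mu> borel (\<lambda>p. p) = distr \<nu> borel (\<lambda>p. p)"
    using distr[OF prob(1) sets(1)] distr[OF prob(2) sets(2)] moments
    by (intro bounded_real_distribution_eqI_moments[where B = 1]) simp_all
  have emeasure_distr_id: "emeasure (distr M borel (\<lambda>p. p)) A = emeasure M A"
    if M: "sets M = sets (restrict_space borel {0<..<1::real})" and A: "A \<in> sets M" for M A
  proof -
    have "A \<in> sets borel" "A \<subseteq> {0<..<1}"
      using A unfolding M by (auto simp: sets_restrict_space_iff)
    moreover have "(\<lambda>p. p) \<in> borel_measurable M"
      by (rule meas[OF M]) simp
    ultimately show ?thesis
      by (simp add: emeasure_distr space[OF M] Int_absorb2)
  qed
  show ?thesis
  proof (rule measure_eqI)
    show "sets \<mu> = sets \<nu>" by (simp add: sets)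
    fix A assume "A \<in> sets \<mu>"
    then show "emeasure \<mu> A = emeasure \<nu> A"
      by (metis emeasure_distr_id[OF sets(1)] emeasure_distr_id[OF sets(2)] distr_eq sets)
  qed
qed

section \<open>The zeta distribution as a mixture of geometric distributions\<close>

theorem theorem1:
  fixes s :: real
  assumes "s > 1"
  shows
    "(\<forall>p\<in>{0<..<1}. 0 \<le> mixing_density s p) \<and>
     set_integrable lborel {0<..<1} (mixing_density s) \<and>
     (LBINT p:{0<..<1}. mixing_density s p) = 1 \<and>
     (\<forall>x::nat.
        set_integrable lborel {0<..<1} (\<lambda>p. neg_binomial_mass 1 p x * mixing_density s p) \<and>
        (LBINT p:{0<..<1}. neg_binomial_mass 1 p x * mixing_density s p) = zeta_mass s x) \<and>
     (\<forall>\<mu>::real measure.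
        prob_space \<mu> \<longrightarrow>
        sets \<mu> = sets (restrict_space borel {0<..<1}) \<longrightarrow>
        (\<forall>x::nat. (LINT p|\<mu>. neg_binomial_mass 1 p x) = zeta_mass s x) \<longrightarrow>
        \<mu> = mixing_measure s)"
proof (intro conjI ballI allI impI)
  show "0 \<le> mixing_density s p" if "p \<in> {0<..<1}" for p
    by (rule mixing_density_nonneg[OF assms that])
  show "set_integrable lborel {0<..<1} (mixing_density s)"
    and "(LBINT p:{0<..<1}. mixing_density s p) = 1"
    using has_bochner_integral_mixing_density[OF assms]
    by (simp_all add: set_integrable_def set_lebesgue_integral_def has_bochner_integral_iff)
  show "set_integrable lborel {0<..<1} (\<lambda>p. neg_binomial_mass 1 p x * mixing_density s p)"
    and "(LBINT p:{0<..<1}. neg_binomial_mass 1 p x * mixing_density s p) = zeta_mass s x" for x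
    using has_bochner_integral_mixture[OF assms, of x]
    by (simp_all add: set_integrable_def set_lebesgue_integral_def has_bochner_integral_iff)
  fix \<mu> :: "real measure"
  assume "prob_space \<mu>" "sets \<mu> = sets (restrict_space borel {0<..<1})"
    and "\<forall>x. (LINT p|\<mu>. neg_binomial_mass 1 p x) = zeta_mass s x"
  then show "\<mu> = mixing_measure s"
    using prob_space_mixing_measure[OF assms] sets_mixing_measure
      integral_mixing_measure_neg_binomial_mass[OF assms]
    by (intro measure_unit_interval_eqI_neg_binomial) simp_all
qed

end
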